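(* For every fixed $\hat t\in[0,T)$ and $a_{\hat t}\in\hat\Lambda_{\hat t}$, define $S^{a_{\hat t}}:\hat\Lambda^{\hat t}\to R$ by $S^{a_{\hat t}}(\gamma_t):=S(\gamma_t,a_{\hat t,t})$ for $(t,\gamma_t)\in[\hat t,T]\times\hat\Lambda^{\hat t}$. Then $S^{a_{\hat t}}\in C^1(\hat\Lambda^{\hat t})$. Moreover, $$\frac{3-5^{1/2}}{2}\|\gamma_t\|_0^2\le S(\gamma_t)+|\gamma_t(t)|^2\le 2\|\gamma_t\|_0^2,\qquad (t,\gamma_t)\in[0,T]\times\hat\Lambda.$$
   Context: Fix $T>0$ and $d\ge1$. For $t\in[0,T]$, $\hat\Lambda_t$ is the set of càdlàg functions $[0,t]\to R^d$; $\hat\Lambda^t=\bigcup_{s\in[t,T]}\hat\Lambda_s$, $\hat\Lambda=\hat\Lambda^0$. A path in $\hat\Lambda_t$ is written $\gamma_t$ (the subscript is the final time), with value $\gamma_t(s)$ at $s\le t$; $(s,\gamma_s)\in[t,T]\times\hat\Lambda^t$ means $s\in[t,T]$, $\gamma_s\in\hat\Lambda_s$. For $t\le\bar t\le T$, $\gamma_{t,\bar t}\in\hat\Lambda_{\bar t}$ equals $\gamma_t$ on $[0,t]$ and $\gamma_t(t)$ on $(t,\bar t]$; for $x\in R^d$, $\gamma_t^x$ equals $\gamma_t$ on $[0,t)$ and $\gamma_t(t)+x$ at $t$. $\|\gamma_t\|_0=\sup_{0\le s\le t}|\gamma_t(s)|$ and, for $t\le\bar t$, $d_\infty(\gamma_t,\bar\gamma_{\bar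 t})=|t-\bar t|+\sup_{0\le s\le\bar t}|\gamma_{t,\bar t}(s)-\bar\gamma_{\bar t}(s)|$ (extended symmetrically). For $\gamma_t,\gamma'_t\in\hat\Lambda_t$, $S(\gamma_t,\gamma'_t)=\dfrac{(\|\gamma_t-\gamma'_t\|_0^2-|\gamma_t(t)-\gamma'_t(t)|^2)^2}{\|\gamma_t-\gamma'_t\|_0^2}$ if $\|\gamma_t-\gamma'_t\|_0\ne0$ and $S(\gamma_t,\gamma'_t)=0$ otherwise; $S(\gamma_t):=S(\gamma_t,0)$ with $0$ the zero path on $[0,t]$. For $f:\hat\Lambda^t\to R$: the horizontal derivative is $\partial_tf(\gamma_s)=\lim_{h\downarrow0}\frac1h[f(\gamma_{s,s+h})-f(\gamma_s)]$ for $s<T$, and $\partial_tf(\gamma_T)=\lim_{s\uparrow T,\,s<T}\partial_tf(\gamma_T|_{[0,s]})$; the vertical derivatives are $\partial_{x_i}f(\gamma_s)=\lim_{h\to0}\frac1h[f(\gamma_s^{he_i})-f(\gamma_s)]$, $i=1,\dots,d$, $e_i$ the standard basis. $C^0(\hat\Lambda^t)$ is the set of $d_\infty$-continuous real functionals; $C^1(\hat\Lambda^t)$ is the set of $f\in C^0(\hat\Lambda^t)$ such that $\partial_tf,\partial_{x_1}f,\dots,\partial_{x_d}f$ exist on all of $\hat\Lambda^t$ and lie in $C^0(\hat\Lambda^t)$. *)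

theory Defs
  imports "HOL-Analysis.Analysis"
begin

text \<open>
  A path with final time \<open>t\<close> is a pair \<open>(t, \<gamma>)\<close>, where \<open>\<gamma>\<close> is extensional on \<open>{0..t}\<close>
  (it has the value \<open>undefined\<close> outside of this interval), so that equality of pairs is
  equality of functions on \<open>[0, t]\<close>. The dimension is \<open>CARD('d)\<close>.
\<close>

type_synonym 'd path = "real \<times> (real \<Rightarrow> real ^ 'd)"

definition cadlag_on :: "real \<Rightarrow> (real \<Rightarrow> real ^ 'd::finite) \<Rightarrow> bool" where
  "cadlag_on t \<gamma> \<longleftrightarrow>
     (\<forall>s. 0 \<le> s \<and> s < t \<longrightarrow> (\<gamma> \<longlongrightarrow> \<gamma> s) (at_right s)) \<and>
     (\<forall>s. 0 < s \<and> s \<le> t \<longrightarrow> (\<exists>l. (\<gamma> \<longlongrightarrow> l) (at_left s)))"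

definition Lam_at :: "real \<Rightarrow> (real \<Rightarrow> real ^ 'd::finite) set" where
  "Lam_at t = {\<gamma> \<in> extensional {0..t}. cadlag_on t \<gamma>}"

definition Lam_from :: "real \<Rightarrow> real \<Rightarrow> ('d::finite) path set" where
  "Lam_from T t = (SIGMA s:{t..T}. Lam_at s)"

definition flat_ext :: "real \<Rightarrow> (real \<Rightarrow> real ^ 'd::finite) \<Rightarrow> real \<Rightarrow> (real \<Rightarrow> real ^ 'd)" where
  "flat_ext t \<gamma> u = (\<lambda>s\<in>{0..u}. if s \<le> t then \<gamma> s else \<gamma> t)"

definition bump :: "real \<Rightarrow> (real \<Rightarrow> real ^ 'd::finite) \<Rightarrow> real ^ 'd \<Rightarrow> (real \<Rightarrow> real ^ 'd)" where
  "bump t \<gamma> x = \<gamma>(t := \<gamma> t + x)"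

definition norm0 :: "real \<Rightarrow> (real \<Rightarrow> real ^ 'd::finite) \<Rightarrow> real" where
  "norm0 t \<gamma> = (SUP s\<in>{0..t}. norm (\<gamma> s))"

text \<open>
  Extending both paths to the later of the two final times gives the symmetric
  definition at once: the path that already lives there is left unchanged.
\<close>

definition d_inf :: "('d::finite) path \<Rightarrow> 'd path \<Rightarrow> real" where
  "d_inf = (\<lambda>(t, \<gamma>) (t', \<gamma>').
     \<bar>t - t'\<bar> +
     (SUP s\<in>{0..max t t'}.
        norm (flat_ext t \<gamma> (max t t') s - flat_ext t' \<gamma>' (max t t') s)))"

definition C0 :: "real \<Rightarrow> real \<Rightarrow> (('d::finite) path \<Rightarrow> real) set" where
  "C0 T t = {f. \<forall>p\<in>Lam_from T t. \<forall>\<epsilon>>0. \<exists>\<delta>>0. \<forall>q\<in>Lam_from T t.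
     d_inf p q < \<delta> \<longrightarrow> \<bar>f q - f p\<bar> < \<epsilon>}"

text \<open>
  \<open>Df\<close> is the horizontal derivative of \<open>f\<close> on all of \<open>Lam_from T t\<close>. At the terminal time
  the derivative is the limit of the values of \<open>Df\<close> itself along the restricted paths.
  This is meant for \<open>t < T\<close>, where these restrictions eventually lie in \<open>Lam_from T t\<close>.
\<close>

definition is_horizontal_deriv ::
  "real \<Rightarrow> real \<Rightarrow> (('d::finite) path \<Rightarrow> real) \<Rightarrow> ('d path \<Rightarrow> real) \<Rightarrow> bool" where
  "is_horizontal_deriv T t f Df \<longleftrightarrow>
     (\<forall>(s, \<gamma>)\<in>Lam_from T t.
        if s < T
        then ((\<lambda>h. (f (s + h, flat_ext s \<gamma> (s + h)) - f (s, \<gamma>)) / h) \<longlongrightarrow> Df (s, \<gamma>)) (at_right 0)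
        else ((\<lambda>r. Df (r, restrict \<gamma> {0..r})) \<longlongrightarrow> Df (s, \<gamma>)) (at_left T))"

definition is_vertical_deriv ::
  "real \<Rightarrow> real \<Rightarrow> 'd \<Rightarrow> (('d::finite) path \<Rightarrow> real) \<Rightarrow> ('d path \<Rightarrow> real) \<Rightarrow> bool" where
  "is_vertical_deriv T t i f Df \<longleftrightarrow>
     (\<forall>(s, \<gamma>)\<in>Lam_from T t.
        ((\<lambda>h. (f (s, bump s \<gamma> (h *\<^sub>R axis i 1)) - f (s, \<gamma>)) / h) \<longlongrightarrow> Df (s, \<gamma>)) (at 0))"

definition C1 :: "real \<Rightarrow> real \<Rightarrow> (('d::finite) path \<Rightarrow> real) set" where
  "C1 T t = {f \<in> C0 T t.
     (\<exists>Df\<in>C0 T t. is_horizontal_deriv T t f Df) \<and>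
     (\<forall>i. \<exists>Df\<in>C0 T t. is_vertical_deriv T t i f Df)}"

definition S2 :: "real \<Rightarrow> (real \<Rightarrow> real ^ 'd::finite) \<Rightarrow> (real \<Rightarrow> real ^ 'd) \<Rightarrow> real" where
  "S2 t \<gamma> \<gamma>' =
     (let M = norm0 t (\<lambda>s. \<gamma> s - \<gamma>' s)
      in if M \<noteq> 0 then (M\<^sup>2 - (norm (\<gamma> t - \<gamma>' t))\<^sup>2)\<^sup>2 / M\<^sup>2 else 0)"

definition S1 :: "real \<Rightarrow> (real \<Rightarrow> real ^ 'd::finite) \<Rightarrow> real" where
  "S1 t \<gamma> = S2 t \<gamma> (\<lambda>s\<in>{0..t}. 0)"

definition S_from :: "real \<Rightarrow> (real \<Rightarrow> real ^ 'd::finite) \<Rightarrow> 'd path \<Rightarrow> real" where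
  "S_from t0 a = (\<lambda>(t, \<gamma>). S2 t \<gamma> (flat_ext t0 a t))"

end

theory Submission imports Defs begin

text \<open>
  Write \<open>m\<close> for the distance \<open>\<parallel>\<gamma>\<^sub>t - a\<parallel>\<^sub>0\<close> and \<open>y\<close> for the terminal difference \<open>\<gamma>\<^sub>t(t) - a(t0)\<close>. Both
  are unchanged by flat extension, so the horizontal derivative vanishes, and both are Lipschitz
  for \<open>d_inf\<close>, so every function of \<open>(m, y)\<close> that is continuous on \<open>\<bar>y\<bar> \<le> m\<close> is a continuous
  functional. A bump at the terminal time changes \<open>y\<close> only and \<open>m = max M \<bar>y\<bar>\<close> with \<open>M\<close> the
  supremum over \<open>[0, t)\<close>; hence \<open>S = ((M\<^sup>2 - \<bar>y\<bar>\<^sup>2)\<^sup>+)\<^sup>2 / M\<^sup>2\<close>, which is differentiable in \<open>y\<close> with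
  gradient \<open>-4 (1 - \<bar>y\<bar>\<^sup>2 / m\<^sup>2) y\<close>.
\<close>

section \<open>Supremum norm and boundedness of cadlag paths\<close>

lemma norm0_upper:
  assumes "bounded (f ` {0..t})" "0 \<le> s" "s \<le> t"
  shows "norm (f s) \<le> norm0 t f"
  unfolding norm0_def
proof (rule cSUP_upper)
  show "bdd_above ((\<lambda>s. norm (f s)) ` {0..t})"
    using assms(1) unfolding bounded_iff bdd_above_def by auto
qed (use assms in auto)

lemma norm0_least:
  assumes "0 \<le> t" "\<And>s. 0 \<le> s \<Longrightarrow> s \<le> t \<Longrightarrow> norm (f s) \<le> B"
  shows "norm0 t f \<le> B"
  unfolding norm0_def by (rule cSUP_least) (use assms in auto)

lemma norm0_cong:
  assumes "\<And>s. 0 \<le> s \<Longrightarrow> s \<le> t \<Longrightarrow> f s = g s"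
  shows "norm0 t f = norm0 t g"
  unfolding norm0_def using assms by (intro SUP_cong) auto

lemma bounded_diff_image:
  assumes "bounded (f ` A)" "bounded (g ` A)"
  shows "bounded ((\<lambda>s. f s - g s :: 'b::real_normed_vector) ` A)"
proof -
  obtain B C where "\<And>s. s \<in> A \<Longrightarrow> norm (f s) \<le> B" "\<And>s. s \<in> A \<Longrightarrow> norm (g s) \<le> C"
    using assms unfolding bounded_iff by fast
  then have "norm (f s - g s) \<le> B + C" if "s \<in> A" for s
    using norm_triangle_ineq4[of "f s" "g s"] that by (smt (verit))
  then show ?thesis
    unfolding bounded_iff by blast
qed

lemma norm0_le_add_diff:
  assumes "0 \<le> t" "bounded (f ` {0..t})" "bounded (g ` {0..t})"
  shows "norm0 t f \<le> norm0 t g + norm0 t (\<lambda>s. f s - g s)"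
proof (rule norm0_least[OF assms(1)])
  fix s assume "0 \<le> s" "s \<le> t"
  then show "norm (f s) \<le> norm0 t g + norm0 t (\<lambda>s. f s - g s)"
    using norm0_upper[OF assms(3)] norm0_upper[OF bounded_diff_image[OF assms(2,3)]]
      norm_triangle_ineq2[of "f s" "g s"] by (smt (verit))
qed

lemma norm0_diff_le:
  assumes "0 \<le> t" "bounded (f ` {0..t})" "bounded (g ` {0..t})"
  shows "\<bar>norm0 t f - norm0 t g\<bar> \<le> norm0 t (\<lambda>s. f s - g s)"
proof -
  have "norm0 t (\<lambda>s. g s - f s) = norm0 t (\<lambda>s. f s - g s)"
    by (simp add: norm0_def norm_minus_commute)
  then show ?thesis
    using norm0_le_add_diff[OF assms] norm0_le_add_diff[OF assms(1,3,2)] by linarith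
qed

lemma tendsto_imp_eventually_norm_le:
  assumes "(f \<longlongrightarrow> l) F"
  shows "\<forall>\<^sub>F x in F. norm (f x) \<le> norm l + 1"
  using order_tendstoD(2)[OF tendsto_norm[OF assms], of "norm l + 1"]
  by (auto elim: eventually_mono)

text \<open>Right continuity and left limits bound the path near every point, and the bisection
  principle \<open>Bolzano\<close> glues these local bounds over the compact interval. Without
  boundedness the real supremum in \<open>norm0\<close> would say nothing.\<close>

lemma cadlag_on_bounded:
  fixes \<gamma> :: "real \<Rightarrow> real ^ 'd::finite"
  assumes "cadlag_on t \<gamma>"
  shows "bounded (\<gamma> ` {0..t})"
proof (cases "0 \<le> t")
  case True
  \<comment> \<open>Naming a copy of the interval keeps \<open>Bolzano\<close> from generalising it
    along with the endpoints. The intersection with \<open>D\<close> matters because the small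
    intervals around \<open>x\<close> may leave \<open>{0..t}\<close>.\<close>
  define D where "D = {0..t}"
  have "bounded (\<gamma> ` ({0..t} \<inter> D))"
    using True
  proof (induction rule: Bolzano)
    case (trans a b c)
    then have "{a..c} = {a..b} \<union> {b..c}" by auto
    then show ?case using trans by (simp add: Int_Un_distrib2 image_Un)
  next
    case (local x)
    have right: "\<exists>d>0. \<exists>B. \<forall>y. x < y \<and> y < x + d \<and> y \<le> t \<longrightarrow> norm (\<gamma> y) \<le> B"
    proof (cases "x < t")
      case True
      then have "\<forall>\<^sub>F y in at_right x. norm (\<gamma> y) \<le> norm (\<gamma> x) + 1"
        using assms local unfolding cadlag_on_def by (intro tendsto_imp_eventually_norm_le) auto
      then obtain b where "b > x" "\<And>y. x < y \<Longrightarrow> y < b \<Longrightarrow> norm (\<gamma> y) \<le> norm (\<gamma> x) + 1"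
        unfolding eventually_at_right_field by blast
      then show ?thesis by (intro exI[of _ "b - x"]) auto
    qed (auto intro: exI[of _ 1])
    have left: "\<exists>d>0. \<exists>B. \<forall>y. x - d < y \<and> y < x \<and> 0 \<le> y \<longrightarrow> norm (\<gamma> y) \<le> B"
    proof (cases "0 < x")
      case True
      then obtain l where "(\<gamma> \<longlongrightarrow> l) (at_left x)"
        using assms local unfolding cadlag_on_def by blast
      then have "\<forall>\<^sub>F y in at_left x. norm (\<gamma> y) \<le> norm l + 1"
        by (rule tendsto_imp_eventually_norm_le)
      then obtain b where "b < x" "\<And>y. b < y \<Longrightarrow> y < x \<Longrightarrow> norm (\<gamma> y) \<le> norm l + 1"
        unfolding eventually_at_left_field by blast
      then show ?thesis by (intro exI[of _ "x - b"]) auto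
    qed (auto intro: exI[of _ 1])
    from left right obtain d1 d2 B1 B2 where d: "d1 > 0" "d2 > 0"
      and B1: "\<And>y. x - d1 < y \<Longrightarrow> y < x \<Longrightarrow> 0 \<le> y \<Longrightarrow> norm (\<gamma> y) \<le> B1"
      and B2: "\<And>y. x < y \<Longrightarrow> y < x + d2 \<Longrightarrow> y \<le> t \<Longrightarrow> norm (\<gamma> y) \<le> B2"
      by blast
    have "bounded (\<gamma> ` ({a..b} \<inter> D))"
      if "a \<le> x" "x \<le> b" "b - a < min d1 d2" for a b
      unfolding bounded_iff
    proof (intro exI[of _ "max (norm (\<gamma> x)) (max B1 B2)"] ballI)
      fix v assume "v \<in> \<gamma> ` ({a..b} \<inter> D)"
      then obtain y where y: "v = \<gamma> y" "a \<le> y" "y \<le> b" "0 \<le> y" "y \<le> t"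
        by (auto simp: D_def)
      then consider "y < x" | "y = x" | "x < y" by linarith
      then show "norm v \<le> max (norm (\<gamma> x)) (max B1 B2)"
        using B1[of y] B2[of y] y that by cases (auto simp: le_max_iff_disj)
    qed
    then show ?case using d by (intro exI[of _ "min d1 d2"]) auto
  qed
  then show ?thesis by (simp add: D_def)
qed simp

lemma Lam_at_bounded: "\<gamma> \<in> Lam_at t \<Longrightarrow> bounded (\<gamma> ` {0..t})"
  unfolding Lam_at_def using cadlag_on_bounded by blast

lemma flat_ext_bounded:
  assumes "bounded (\<gamma> ` {0..t})" "0 \<le> t"
  shows "bounded (flat_ext t \<gamma> u ` {0..u})"
  using assms(1) by (rule bounded_subset) (use assms(2) in \<open>auto simp: flat_ext_def\<close>)

section \<open>Distance and terminal difference as coordinates\<close>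

definition gap :: "real \<Rightarrow> (real \<Rightarrow> real ^ 'd::finite) \<Rightarrow> 'd path \<Rightarrow> real" where
  "gap t0 a = (\<lambda>(t, \<gamma>). norm0 t (\<lambda>s. \<gamma> s - flat_ext t0 a t s))"

definition end_gap :: "real \<Rightarrow> (real \<Rightarrow> real ^ 'd::finite) \<Rightarrow> 'd path \<Rightarrow> real ^ 'd" where
  "end_gap t0 a = (\<lambda>(t, \<gamma>). \<gamma> t - flat_ext t0 a t t)"

text \<open>Division by zero yields \<open>0\<close>, which absorbs the case distinction of
  \<open>S2\<close>.\<close>

lemma S_from_eq:
  "S_from t0 a p = ((gap t0 a p)\<^sup>2 - (norm (end_gap t0 a p))\<^sup>2)\<^sup>2 / (gap t0 a p)\<^sup>2"
  unfolding S_from_def S2_def gap_def end_gap_def Let_def by (cases p) auto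

text \<open>Beyond \<open>t\<close> both paths are frozen, the reference path already since
  \<open>t0\<close>, so their difference takes no new values there.\<close>

lemma gap_flat_ext:
  assumes "0 \<le> t0" "t0 \<le> t" "t \<le> u"
  shows "gap t0 a (u, flat_ext t \<gamma> u) = gap t0 a (t, \<gamma>)"
proof -
  have "(\<lambda>s. norm (flat_ext t \<gamma> u s - flat_ext t0 a u s)) ` {0..u} =
    (\<lambda>s. norm (\<gamma> s - flat_ext t0 a t s)) ` {0..t}" (is "?f ` _ = ?g ` _")
  proof (intro subset_antisym subsetI)
    fix v assume "v \<in> ?f ` {0..u}"
    then obtain s where s: "v = ?f s" "0 \<le> s" "s \<le> u" by auto
    then have "v = ?g (min s t)" using assms by (auto simp: flat_ext_def min_def)
    then show "v \<in> ?g ` {0..t}" using s assms by auto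
  next
    fix v assume "v \<in> ?g ` {0..t}"
    then obtain s where s: "v = ?g s" "0 \<le> s" "s \<le> t" by auto
    then have "v = ?f s" using assms by (auto simp: flat_ext_def)
    then show "v \<in> ?f ` {0..u}" using s assms by auto
  qed
  then show ?thesis unfolding gap_def norm0_def by simp
qed

lemma end_gap_flat_ext:
  assumes "0 \<le> t0" "t0 \<le> t" "t \<le> u"
  shows "end_gap t0 a (u, flat_ext t \<gamma> u) = end_gap t0 a (t, \<gamma>)"
  using assms unfolding end_gap_def flat_ext_def by auto

text \<open>After flat extension to the later final time \<open>u\<close> the reference path cancels
  from \<open>f - g\<close>, which leaves the supremum in \<open>d_inf\<close>. The first bound is
  then the reverse triangle inequality, the second reads off \<open>f - g\<close> at
  \<open>u\<close>.\<close>

lemma gap_lipschitz: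
  assumes "0 \<le> t0" "a \<in> Lam_at t0" "p \<in> Lam_from T t0" "q \<in> Lam_from T t0"
  shows "\<bar>gap t0 a q - gap t0 a p\<bar> \<le> d_inf p q"
    and "norm (end_gap t0 a q - end_gap t0 a p) \<le> d_inf p q"
proof -
  obtain t \<gamma> t' \<gamma>' where p: "p = (t, \<gamma>)" and q: "q = (t', \<gamma>')" by fastforce
  define u where "u = max t t'"
  define f where "f = (\<lambda>s. flat_ext t \<gamma> u s - flat_ext t0 a u s)"
  define g where "g = (\<lambda>s. flat_ext t' \<gamma>' u s - flat_ext t0 a u s)"
  have t: "t0 \<le> t" "t0 \<le> t'" "t \<le> u" "t' \<le> u" "0 \<le> u" "0 \<le> t" "0 \<le> t'"
    using assms p q by (auto simp: Lam_from_def u_def)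
  have bd: "bounded (flat_ext t \<gamma> u ` {0..u})" "bounded (flat_ext t' \<gamma>' u ` {0..u})"
      "bounded (flat_ext t0 a u ` {0..u})"
    using assms p q t by (auto simp: Lam_from_def intro: flat_ext_bounded Lam_at_bounded)
  have bfg: "bounded (f ` {0..u})" "bounded (g ` {0..u})"
    unfolding f_def g_def using bd by (auto intro: bounded_diff_image)
  have d: "norm0 u (\<lambda>s. f s - g s) \<le> d_inf p q"
    unfolding p q d_inf_def norm0_def f_def g_def u_def by simp
  have gap: "gap t0 a p = norm0 u f" "gap t0 a q = norm0 u g"
    unfolding p q f_def g_def
    using gap_flat_ext[OF assms(1), of t u a \<gamma>] gap_flat_ext[OF assms(1), of t' u a \<gamma>'] t
    by (simp_all add: gap_def)
  have end_gap: "end_gap t0 a p = f u" "end_gap t0 a q = g u"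
    unfolding p q f_def g_def
    using end_gap_flat_ext[OF assms(1), of t u a \<gamma>] end_gap_flat_ext[OF assms(1), of t' u a \<gamma>'] t
    by (simp_all add: end_gap_def)
  show "\<bar>gap t0 a q - gap t0 a p\<bar> \<le> d_inf p q"
    using norm0_diff_le[OF \<open>0 \<le> u\<close> bfg] d unfolding gap by linarith
  show "norm (end_gap t0 a q - end_gap t0 a p) \<le> d_inf p q"
    using norm0_upper[OF bounded_diff_image[OF bfg], of u] d t
    unfolding end_gap by (simp add: norm_minus_commute)
qed

text \<open>Places the pair of coordinates in the cone on which the profiles below are
  continuous.\<close>

lemma norm_end_gap_le:
  assumes "0 \<le> t0" "a \<in> Lam_at t0" "p \<in> Lam_from T t0"
  shows "norm (end_gap t0 a p) \<le> gap t0 a p"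
proof -
  obtain t \<gamma> where p: "p = (t, \<gamma>)" by fastforce
  have "bounded ((\<lambda>s. \<gamma> s - flat_ext t0 a t s) ` {0..t})"
    using assms p
    by (auto simp: Lam_from_def intro!: bounded_diff_image intro: flat_ext_bounded Lam_at_bounded)
  then show ?thesis
    using norm0_upper[of "\<lambda>s. \<gamma> s - flat_ext t0 a t s" t t] assms(1,3) p
    by (auto simp: gap_def end_gap_def Lam_from_def)
qed

section \<open>Continuous functionals from continuous functions on a cone\<close>

lemma C0_gap_compose:
  fixes a :: "real \<Rightarrow> real ^ 'd::finite"
  assumes "0 \<le> t0" "a \<in> Lam_at t0"
    and cont: "continuous_on {z. norm (snd z) \<le> fst z} G"
  shows "(\<lambda>p. G (gap t0 a p, end_gap t0 a p)) \<in> C0 T t0"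
  unfolding C0_def
proof (intro CollectI ballI allI impI)
  fix p :: "'d path" and \<epsilon> :: real
  assume p: "p \<in> Lam_from T t0" and "\<epsilon> > 0"
  define F where "F = (\<lambda>p. (gap t0 a p, end_gap t0 a p))"
  have F_mem: "F q \<in> {z. norm (snd z) \<le> fst z}" if "q \<in> Lam_from T t0" for q
    using norm_end_gap_le[OF assms(1,2) that] by (simp add: F_def)
  obtain \<delta> where "\<delta> > 0"
    and \<delta>: "\<And>z. norm (snd z) \<le> fst z \<Longrightarrow> dist z (F p) < \<delta> \<Longrightarrow> dist (G z) (G (F p)) < \<epsilon>"
    using cont[unfolded continuous_on_iff, rule_format, OF F_mem[OF p] \<open>\<epsilon> > 0\<close>] by auto
  \<comment> \<open>Each coordinate moves by at most \<open>d_inf p q\<close>, and the product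
    distance is at most the sum of both moves; hence half of \<open>\<delta>\<close>.\<close>
  have "\<bar>G (F q) - G (F p)\<bar> < \<epsilon>" if q: "q \<in> Lam_from T t0" "d_inf p q < \<delta> / 2" for q
  proof -
    have "dist (F q) (F p) \<le> \<bar>gap t0 a q - gap t0 a p\<bar> + norm (end_gap t0 a q - end_gap t0 a p)"
      unfolding F_def dist_prod_def using sqrt_sum_squares_le_sum_abs[of "gap t0 a q - gap t0 a p"
        "norm (end_gap t0 a q - end_gap t0 a p)"] by (simp add: dist_norm)
    also have "\<dots> < \<delta>"
      using gap_lipschitz[OF assms(1,2) p q(1)] q(2) by linarith
    finally show ?thesis
      using \<delta>[of "F q"] F_mem[OF q(1)] by (simp add: dist_real_def)
  qed
  then show "\<exists>\<delta>>0. \<forall>q\<in>Lam_from T t0. d_inf p q < \<delta> \<longrightarrow>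
      \<bar>G (gap t0 a q, end_gap t0 a q) - G (gap t0 a p, end_gap t0 a p)\<bar> < \<epsilon>"
    using \<open>\<delta> > 0\<close> unfolding F_def by (intro exI[of _ "\<delta> / 2"]) auto
qed

text \<open>Inside the cone \<open>fst z = 0\<close> happens only at the apex. There the bound
  forces the value \<open>0\<close> and squeezes \<open>G\<close> to it; at all other points of the
  cone the first hypothesis applies.\<close>

lemma continuous_on_cone:
  fixes G :: "real \<times> 'a::real_normed_vector \<Rightarrow> real"
  assumes cont: "\<And>z. fst z \<noteq> 0 \<Longrightarrow> isCont G z"
    and bound: "\<And>z. norm (snd z) \<le> fst z \<Longrightarrow> \<bar>G z\<bar> \<le> norm (snd z)"
  shows "continuous_on {z. norm (snd z) \<le> fst z} G"
  unfolding continuous_on_eq_continuous_within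
proof
  fix z :: "real \<times> 'a"
  assume z: "z \<in> {z. norm (snd z) \<le> fst z}"
  show "continuous (at z within {z. norm (snd z) \<le> fst z}) G"
  proof (cases "fst z = 0")
    case True
    then have "z = 0" using z by (simp add: prod_eq_iff)
    then have G: "G z = 0" using bound[of z] by simp
    have lim: "((\<lambda>w. norm (snd w)) \<longlongrightarrow> 0) (at z within {z. norm (snd z) \<le> fst z})"
      using \<open>z = 0\<close> by (auto intro!: tendsto_eq_intros)
    show ?thesis
      unfolding continuous_within G
      by (rule Lim_null_comparison[OF _ lim]) (auto simp: eventually_at_filter bound)
  next
    case False
    then show ?thesis using cont continuous_at_imp_continuous_at_within by blast
  qed
qed

text \<open>The quotient is the square of \<open>m - |y|^2 / m\<close>, and on the cone
  \<open>|y|^2 / m\<close> is at most \<open>|y|\<close>, so \<open>continuous_on_cone\<close>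
  handles the singular term.\<close>

lemma continuous_on_S_profile:
  "continuous_on {z. norm (snd z) \<le> fst z}
     (\<lambda>z :: real \<times> 'a::real_normed_vector. ((fst z)\<^sup>2 - (norm (snd z))\<^sup>2)\<^sup>2 / (fst z)\<^sup>2)"
proof -
  have "continuous_on {z. norm (snd z) \<le> fst z}
      (\<lambda>z :: real \<times> 'a. (norm (snd z))\<^sup>2 / fst z)"
  proof (rule continuous_on_cone)
    fix z :: "real \<times> 'a"
    assume z: "norm (snd z) \<le> fst z"
    then have "0 \<le> fst z" using norm_ge_zero order_trans by blast
    then show "\<bar>(norm (snd z))\<^sup>2 / fst z\<bar> \<le> norm (snd z)"
      using z by (auto simp: divide_simps power2_eq_square mult_left_mono)
  qed (auto intro!: continuous_intros)
  from continuous_on_power[OF continuous_on_diff[OF continuous_on_fst[OF continuous_on_id] this]]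
  have "continuous_on {z. norm (snd z) \<le> fst z}
      (\<lambda>z :: real \<times> 'a. (fst z - (norm (snd z))\<^sup>2 / fst z)\<^sup>2)" .
  then show ?thesis
  proof (rule continuous_on_eq)
    fix z :: "real \<times> 'a"
    assume "z \<in> {z. norm (snd z) \<le> fst z}"
    show "(fst z - (norm (snd z))\<^sup>2 / fst z)\<^sup>2 = ((fst z)\<^sup>2 - (norm (snd z))\<^sup>2)\<^sup>2 / (fst z)\<^sup>2"
    proof (cases "fst z = 0")
      case False
      then show ?thesis
        by (simp add: field_simps power2_eq_square)
    qed simp
  qed
qed

text \<open>Splitting off the linear term leaves a component times a factor in
  \<open>[0, 1]\<close>, which meets the bound required at the apex.\<close>

lemma continuous_on_S_gradient:
  "continuous_on {z. norm (snd z) \<le> fst z}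
     (\<lambda>z :: real \<times> (real ^ 'd::finite).
        - 4 * ((fst z)\<^sup>2 - (norm (snd z))\<^sup>2) / (fst z)\<^sup>2 * (snd z $ i))"
proof -
  have "continuous_on {z. norm (snd z) \<le> fst z}
      (\<lambda>z :: real \<times> (real ^ 'd). (norm (snd z) / fst z)\<^sup>2 * (snd z $ i))"
  proof (rule continuous_on_cone)
    fix z :: "real \<times> (real ^ 'd)"
    assume z: "norm (snd z) \<le> fst z"
    then have "0 \<le> fst z" using norm_ge_zero order_trans by blast
    then have "0 \<le> norm (snd z) / fst z" "norm (snd z) / fst z \<le> 1"
      using z by (auto simp: divide_simps)
    then have "(norm (snd z) / fst z)\<^sup>2 \<le> 1" by (simp add: power_le_one)
    moreover have "\<bar>snd z $ i\<bar> \<le> norm (snd z)" by (rule component_le_norm_cart)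
    ultimately have "(norm (snd z) / fst z)\<^sup>2 * \<bar>snd z $ i\<bar> \<le> 1 * norm (snd z)"
      by (intro mult_mono) auto
    then show "\<bar>(norm (snd z) / fst z)\<^sup>2 * (snd z $ i)\<bar> \<le> norm (snd z)"
      by (simp add: abs_mult)
  qed (auto intro!: continuous_intros)
  moreover have "continuous_on {z. norm (snd z) \<le> fst z} (\<lambda>z :: real \<times> (real ^ 'd). snd z $ i)"
    by (intro continuous_intros)
  ultimately have "continuous_on {z. norm (snd z) \<le> fst z}
      (\<lambda>z :: real \<times> (real ^ 'd). - 4 * (snd z $ i - (norm (snd z) / fst z)\<^sup>2 * (snd z $ i)))"
    by (intro continuous_on_mult_left continuous_on_diff)
  then show ?thesis
  proof (rule continuous_on_eq)
    fix z :: "real \<times> (real ^ 'd)"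
    assume z: "z \<in> {z. norm (snd z) \<le> fst z}"
    show "- 4 * (snd z $ i - (norm (snd z) / fst z)\<^sup>2 * (snd z $ i)) =
        - 4 * ((fst z)\<^sup>2 - (norm (snd z))\<^sup>2) / (fst z)\<^sup>2 * (snd z $ i)"
    \<comment> \<open>Division by zero alone does not suffice here: the linear term survives it and
      vanishes only because the cone forces \<open>snd z = 0\<close>.\<close>
    proof (cases "fst z = 0")
      case True
      then show ?thesis using z by simp
    next
      case False
      then show ?thesis by (simp add: field_simps)
    qed
  qed
qed

section \<open>Vertical and horizontal derivatives\<close>

lemma DERIV_max_0_power2:
  "((\<lambda>u::real. (max 0 u)\<^sup>2) has_real_derivative 2 * max 0 u) (at u)"
proof -
  consider "u < 0" | "u = 0" | "u > 0" by linarith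
  then show ?thesis
  proof cases
    case 1
    have "((\<lambda>_::real. 0) has_real_derivative 2 * max 0 u) (at u)"
      using 1 by (auto intro!: derivative_eq_intros)
    then show ?thesis
      by (rule has_field_derivative_transform_within[where d = "- u"])
        (use 1 in \<open>auto simp: dist_real_def\<close>)
  next
    case 2
    \<comment> \<open>Squaring removes the kink of the positive part: the difference quotient is
      dominated by \<open>\<bar>h\<bar>\<close>. For the functional this is the transition
      \<open>|y| = M\<close>.\<close>
    have "((\<lambda>h::real. (max 0 h)\<^sup>2 / h) \<longlongrightarrow> 0) (at 0)"
    proof (rule Lim_null_comparison)
      show "\<forall>\<^sub>F h in at 0. norm ((max 0 h)\<^sup>2 / h) \<le> \<bar>h::real\<bar>"
        by (rule always_eventually) (auto simp: max_def power2_eq_square)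
      show "((\<lambda>h::real. \<bar>h\<bar>) \<longlongrightarrow> 0) (at 0)"
        by (auto intro!: tendsto_eq_intros)
    qed
    then show ?thesis using 2 by (simp add: DERIV_def)
  next
    case 3
    have "((\<lambda>u::real. u\<^sup>2) has_real_derivative 2 * max 0 u) (at u)"
      using 3 by (auto intro!: derivative_eq_intros)
    then show ?thesis
      by (rule has_field_derivative_transform_within[where d = u])
        (use 3 in \<open>auto simp: dist_real_def\<close>)
  qed
qed

text \<open>Isolates the dependence on the terminal value: one \<open>M\<close> serves all
  \<open>v\<close>, so a bump can be differentiated with \<open>M\<close> held fixed.\<close>

lemma norm0_fun_upd_end:
  assumes "0 \<le> t" "bounded (f ` {0..t})"
  obtains M where "0 \<le> M" "\<And>v. norm0 t (f(t := v)) = max M (norm v)"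
proof (cases "t = 0")
  case True
  \<comment> \<open>There is no earlier time, and \<open>0\<close> stands in for the empty supremum
    because norms are nonnegative.\<close>
  have "norm0 t (f(t := v)) = max 0 (norm v)" for v
    unfolding norm0_def True by simp
  then show ?thesis using that[of 0] by simp
next
  case False
  define M where "M = (SUP s\<in>{0..<t}. norm (f s))"
  have bdd: "bdd_above ((\<lambda>s. norm (f s)) ` {0..<t})"
    using assms(2) unfolding bounded_iff bdd_above_def by fastforce
  have "norm (f 0) \<le> M"
    unfolding M_def by (rule cSUP_upper[OF _ bdd]) (use assms False in auto)
  then have "0 \<le> M" using norm_ge_zero order_trans by blast
  moreover have "norm0 t (f(t := v)) = max M (norm v)" for v
  proof -
    have "{0..t} = insert t {0..<t}" using assms(1) by auto
    then have "norm0 t (f(t := v)) = Sup (insert (norm v) ((\<lambda>s. norm (f s)) ` {0..<t}))"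
      unfolding norm0_def by (auto intro!: arg_cong[where f = Sup])
    also have "\<dots> = max (norm v) M"
      unfolding M_def using bdd False assms(1) by (subst cSup_insert) (auto simp: sup_max)
    finally show ?thesis by (simp add: max.commute)
  qed
  ultimately show ?thesis using that by blast
qed

text \<open>Along a bump in direction \<open>i\<close> the functional is the squared positive part
  of a quadratic polynomial in \<open>h\<close>, divided by a constant, so the chain rule
  applies.\<close>

lemma vertical_deriv_S_from:
  fixes a :: "real \<Rightarrow> real ^ 'd::finite"
  assumes "0 \<le> t0" "a \<in> Lam_at t0"
  shows "is_vertical_deriv T t0 i (S_from t0 a)
    (\<lambda>p. - 4 * ((gap t0 a p)\<^sup>2 - (norm (end_gap t0 a p))\<^sup>2) / (gap t0 a p)\<^sup>2 * (end_gap t0 a p $ i))"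
  unfolding is_vertical_deriv_def
proof safe
  fix t and \<gamma> :: "real \<Rightarrow> real ^ 'd"
  assume mem: "(t, \<gamma>) \<in> Lam_from T t0"
  then have t: "t0 \<le> t" "0 \<le> t" and \<gamma>: "\<gamma> \<in> Lam_at t"
    using assms(1) by (auto simp: Lam_from_def)
  define f where "f = (\<lambda>s. \<gamma> s - flat_ext t0 a t s)"
  define y where "y = end_gap t0 a (t, \<gamma>)"
  define e :: "real ^ 'd" where "e = axis i 1"
  have "bounded (f ` {0..t})"
    unfolding f_def using \<gamma> assms
    by (auto intro!: bounded_diff_image intro: flat_ext_bounded Lam_at_bounded)
  then obtain M where "0 \<le> M" and M: "\<And>v. norm0 t (f(t := v)) = max M (norm v)"
    using norm0_fun_upd_end t by blast
  have gap: "gap t0 a (t, bump t \<gamma> x) = max M (norm (y + x))" for x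
  proof -
    have "gap t0 a (t, bump t \<gamma> x) = norm0 t (f(t := y + x))"
      unfolding gap_def y_def end_gap_def f_def bump_def by (auto intro: norm0_cong)
    then show ?thesis by (simp add: M)
  qed
  have end_gap: "end_gap t0 a (t, bump t \<gamma> x) = y + x" for x
    unfolding end_gap_def y_def bump_def by simp
  have bump0: "bump t \<gamma> 0 = \<gamma>" by (simp add: bump_def)
  \<comment> \<open>If \<open>|y + x|\<close> exceeds \<open>M\<close>, the gap equals
    \<open>|y + x|\<close> and the numerator vanishes, as does the positive part. The denominator
    can therefore be the fixed \<open>M\<^sup>2\<close> for every bump.\<close>
  have S: "S_from t0 a (t, bump t \<gamma> x) = (max 0 (M\<^sup>2 - (norm (y + x))\<^sup>2))\<^sup>2 / M\<^sup>2" for x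
  proof (cases "norm (y + x) \<le> M")
    case True
    then have "(norm (y + x))\<^sup>2 \<le> M\<^sup>2" by (simp add: power_mono)
    then show ?thesis using True by (simp add: S_from_eq gap end_gap max_absorb1 max_absorb2)
  next
    case False
    then have "M\<^sup>2 \<le> (norm (y + x))\<^sup>2" using \<open>0 \<le> M\<close> by (simp add: power_mono)
    then show ?thesis using False by (simp add: S_from_eq gap end_gap max_absorb1 max_absorb2)
  qed
  \<comment> \<open>Expanding the square gives a polynomial in \<open>h\<close>, so the singularity
    of the norm at the origin never enters.\<close>
  have norm_eq: "(norm (y + h *\<^sub>R e))\<^sup>2 = (norm y)\<^sup>2 + 2 * h * (y $ i) + h\<^sup>2" for h
    unfolding power2_norm_eq_inner e_def
    by (simp add: inner_add_left inner_add_right inner_axis inner_axis' power2_eq_square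
        algebra_simps)
  have "((\<lambda>h. M\<^sup>2 - (norm (y + h *\<^sub>R e))\<^sup>2) has_real_derivative - 2 * (y $ i)) (at 0)"
    unfolding norm_eq by (auto intro!: derivative_eq_intros)
  from DERIV_cdivide[OF DERIV_chain2[OF DERIV_max_0_power2 this], of "M\<^sup>2"]
  have "((\<lambda>h. S_from t0 a (t, bump t \<gamma> (h *\<^sub>R e))) has_real_derivative
      2 * max 0 (M\<^sup>2 - (norm y)\<^sup>2) * (- 2 * (y $ i)) / M\<^sup>2) (at 0)"
    unfolding S by simp
  \<comment> \<open>Back from \<open>M\<close> to the gap: they agree if \<open>|y| \<le> M\<close>;
    otherwise the gap is \<open>|y|\<close> and both sides are \<open>0\<close>.\<close>
  moreover have "2 * max 0 (M\<^sup>2 - (norm y)\<^sup>2) * (- 2 * (y $ i)) / M\<^sup>2 =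
      - 4 * ((gap t0 a (t, \<gamma>))\<^sup>2 - (norm y)\<^sup>2) / (gap t0 a (t, \<gamma>))\<^sup>2 * (y $ i)"
  proof (cases "norm y \<le> M")
    case True
    then have "(norm y)\<^sup>2 \<le> M\<^sup>2" by (simp add: power_mono)
    then show ?thesis using True gap[of 0] by (simp add: bump0 max_absorb1 max_absorb2 algebra_simps)
  next
    case False
    then have "M\<^sup>2 \<le> (norm y)\<^sup>2" using \<open>0 \<le> M\<close> by (simp add: power_mono)
    then show ?thesis using False gap[of 0] by (simp add: bump0 max_absorb1 max_absorb2)
  qed
  ultimately show "((\<lambda>h. (S_from t0 a (t, bump t \<gamma> (h *\<^sub>R axis i 1)) - S_from t0 a (t, \<gamma>)) / h) \<longlongrightarrow>
      - 4 * ((gap t0 a (t, \<gamma>))\<^sup>2 - (norm (end_gap t0 a (t, \<gamma>)))\<^sup>2) / (gap t0 a (t, \<gamma>))\<^sup>2 *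
        (end_gap t0 a (t, \<gamma>) $ i)) (at 0)"
    unfolding DERIV_def by (simp add: bump0 y_def e_def)
qed

lemma horizontal_deriv_S_from:
  assumes "0 \<le> t0"
  shows "is_horizontal_deriv T t0 (S_from t0 a) (\<lambda>_. 0)"
proof -
  have "S_from t0 a (s + h, flat_ext s \<gamma> (s + h)) = S_from t0 a (s, \<gamma>)" if "t0 \<le> s" "0 < h" for s h \<gamma>
    using gap_flat_ext[of t0 s "s + h" a \<gamma>] end_gap_flat_ext[of t0 s "s + h" a \<gamma>] assms that
    by (simp add: S_from_eq)
  \<comment> \<open>Before the terminal time every quotient with \<open>h > 0\<close> is exactly
    \<open>0\<close>; at the terminal time the limit is that of the zero functional itself.\<close>
  then show ?thesis
    unfolding is_horizontal_deriv_def
    by (auto simp: Lam_from_def eventually_at_filter intro!: tendsto_eventually)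
qed

lemma S_from_C1:
  fixes a :: "real \<Rightarrow> real ^ 'd::finite"
  assumes "0 \<le> t0" "a \<in> Lam_at t0"
  shows "S_from t0 a \<in> C1 T t0"
proof -
  have "S_from t0 a \<in> C0 T t0"
    using C0_gap_compose[OF assms continuous_on_S_profile, of T]
    by (simp add: S_from_eq[abs_def])
  moreover have "(\<lambda>_. 0) \<in> C0 T t0"
    unfolding C0_def by (auto intro: exI[of _ 1])
  moreover have "\<exists>Df\<in>C0 T t0. is_vertical_deriv T t0 i (S_from t0 a) Df" for i
    using C0_gap_compose[OF assms continuous_on_S_gradient[of i], of T]
      vertical_deriv_S_from[OF assms, of T i]
    by (intro bexI) auto
  ultimately show ?thesis
    unfolding C1_def using horizontal_deriv_S_from[OF assms(1)] by blast
qed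

section \<open>The two-sided bound\<close>

text \<open>With \<open>r = q / m\<close> the middle term is \<open>m (1 - r + r\<^sup>2)\<close>, which lies in \<open>[3m/4, m]\<close>.\<close>

lemma S_profile_bounds:
  fixes m q :: real
  assumes "0 \<le> q" "q \<le> m"
  shows "(3 - sqrt 5) / 2 * m \<le> (m - q)\<^sup>2 / m + q" "(m - q)\<^sup>2 / m + q \<le> 2 * m"
proof -
  \<comment> \<open>This puts the constant at or below \<open>1 / 2\<close>, hence below the
    \<open>3 / 4\<close> proved next. Likewise the upper bound is first obtained with
    \<open>m\<close> and then weakened to \<open>2 * m\<close>.\<close>
  have "2 \<le> sqrt 5" by (rule real_le_rsqrt) simp
  then have "(3 - sqrt 5) / 2 * m \<le> 3 / 4 * m"
    using assms by (intro mult_right_mono) auto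
  moreover have "3 / 4 * m \<le> (m - q)\<^sup>2 / m + q \<and> (m - q)\<^sup>2 / m + q \<le> m"
  proof (cases "m = 0")
    case False
    then have "0 < m" using assms by linarith
    \<comment> \<open>Completing the square in \<open>q\<close> gives the lower bound; the factored
      form after it gives the upper one.\<close>
    have "(m - q)\<^sup>2 / m + q = 3 / 4 * m + (q - m / 2)\<^sup>2 / m"
      using \<open>0 < m\<close> by (simp add: field_simps power2_eq_square)
    moreover have "(m - q)\<^sup>2 / m + q = m - q * (m - q) / m"
      using \<open>0 < m\<close> by (simp add: field_simps power2_eq_square)
    moreover have "0 \<le> q * (m - q) / m" "0 \<le> (q - m / 2)\<^sup>2 / m"
      using \<open>0 < m\<close> assms by simp_all
    ultimately show ?thesis by linarith
  qed (use assms in auto)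
  ultimately show "(3 - sqrt 5) / 2 * m \<le> (m - q)\<^sup>2 / m + q" "(m - q)\<^sup>2 / m + q \<le> 2 * m"
    using assms by linarith+
qed

lemma S1_eq:
  assumes "0 \<le> t"
  shows "S1 t \<gamma> = ((norm0 t \<gamma>)\<^sup>2 - (norm (\<gamma> t))\<^sup>2)\<^sup>2 / (norm0 t \<gamma>)\<^sup>2"
proof -
  \<comment> \<open>The zero path is \<open>undefined\<close> off \<open>{0..t}\<close>, so the two
    functions are compared only on the interval that \<open>norm0\<close> sees.\<close>
  have "norm0 t (\<lambda>s. \<gamma> s - restrict (\<lambda>_. 0) {0..t} s) = norm0 t \<gamma>"
    by (rule norm0_cong) simp
  then show ?thesis using assms unfolding S1_def S2_def Let_def by simp
qed

theorem lemma2p8: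
  fixes T :: real
  assumes "0 < T"
  shows "(\<forall>t0\<in>{0..<T}. \<forall>a\<in>Lam_at t0.
            S_from t0 (a :: real \<Rightarrow> real ^ 'd::finite) \<in> C1 T t0) \<and>
         (\<forall>(t, \<gamma> :: real \<Rightarrow> real ^ 'd)\<in>Lam_from T 0.
            (3 - sqrt 5) / 2 * (norm0 t \<gamma>)\<^sup>2 \<le> S1 t \<gamma> + (norm (\<gamma> t))\<^sup>2 \<and>
            S1 t \<gamma> + (norm (\<gamma> t))\<^sup>2 \<le> 2 * (norm0 t \<gamma>)\<^sup>2)"
proof (intro conjI)
  show "\<forall>t0\<in>{0..<T}. \<forall>a\<in>Lam_at t0. S_from t0 (a :: real \<Rightarrow> real ^ 'd) \<in> C1 T t0"
    using S_from_C1 by auto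
  show "\<forall>(t, \<gamma> :: real \<Rightarrow> real ^ 'd)\<in>Lam_from T 0.
      (3 - sqrt 5) / 2 * (norm0 t \<gamma>)\<^sup>2 \<le> S1 t \<gamma> + (norm (\<gamma> t))\<^sup>2 \<and>
      S1 t \<gamma> + (norm (\<gamma> t))\<^sup>2 \<le> 2 * (norm0 t \<gamma>)\<^sup>2"
  proof (clarify, goal_cases)
    case (1 t \<gamma>)
    then have t: "0 \<le> t" "\<gamma> \<in> Lam_at t" by (auto simp: Lam_from_def)
    then have "norm (\<gamma> t) \<le> norm0 t \<gamma>" by (intro norm0_upper Lam_at_bounded) auto
    then have "(norm (\<gamma> t))\<^sup>2 \<le> (norm0 t \<gamma>)\<^sup>2" by (simp add: power_mono)
    \<comment> \<open>The profile is applied to squared norms, with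
      \<open>m = (norm0 t \<gamma>)\<^sup>2\<close> and
      \<open>q = (norm (\<gamma> t))\<^sup>2\<close>.\<close>
    from S_profile_bounds[OF _ this] show ?case
      unfolding S1_eq[OF t(1)] by simp
  qed
qed

end
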